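(* Let $A\in M_{d\times d}$ have $d$ distinct eigenvalues, and let $\mathbf{x}(t)$, $t\in[0,T]$, be the solution trajectory of $D\mathbf{x}(t)=A\mathbf{x}(t)$ initiated at $\mathbf{x}_0:=\mathbf{x}(0)\in\mathbb{R}^d$. Then the ODE system is identifiable at $\mathbf{x}_0$ if and only if the pairwise inner product matrix $\Sigma_{\mathbf{x}\mathbf{x}}$ is nonsingular (invertible).
   Context: $M_{d\times d}$ is the set of real $d\times d$ matrices, $D=\frac{d}{dt}$, and $T>0$ is fixed. The solution is $\mathbf{x}(t|A,\mathbf{x}_0)=e^{tA}\mathbf{x}_0$. Identifiability: $A$ is identifiable at $\mathbf{x}_0$ if for all $B\in M_{d\times d}$ with $B\neq A$, $\mathbf{x}(t|A,\mathbf{x}_0)\neq\mathbf{x}(t|B,\mathbf{x}_0)$ for some $0<t<T$. Pairwise inner product matrix: $\Sigma_{\mathbf{x}\mathbf{x}}$ is the $d\times d$ matrix with entries $(\Sigma_{\mathbf{x}\mathbf{x}})_{ij}=\int_0^T x_i(t)x_j(t)\,dt$. *)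

theory Defs
  imports "HOL-Analysis.Analysis"
begin

definition matrix_power :: "real^'n^'n \<Rightarrow> nat \<Rightarrow> real^'n^'n" where
  "matrix_power A k = (((**) A) ^^ k) (mat 1)"

(* The type real^'n^'n is not an instance of the class on which the library's exp is defined
   (its multiplication is componentwise), so the exponential series is written out. *)
definition matrix_exp :: "real^'n^'n \<Rightarrow> real^'n^'n" where
  "matrix_exp A = (\<Sum>k. (1 / fact k) *\<^sub>R matrix_power A k)"

definition trajectory :: "real^'n^'n \<Rightarrow> real^'n \<Rightarrow> real \<Rightarrow> real^'n" where
  "trajectory A x0 t = matrix_exp (t *\<^sub>R A) *v x0"

definition identifiable_at :: "real \<Rightarrow> real^'n^'n \<Rightarrow> real^'n \<Rightarrow> bool" where
  "identifiable_at T A x0 \<longleftrightarrow>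
     (\<forall>B. B \<noteq> A \<longrightarrow> (\<exists>t. 0 < t \<and> t < T \<and> trajectory A x0 t \<noteq> trajectory B x0 t))"

definition inner_product_matrix :: "real \<Rightarrow> (real \<Rightarrow> real^'n) \<Rightarrow> real^'n^'n" where
  "inner_product_matrix T x = (\<chi> i j. integral {0..T} (\<lambda>t. x t $ i * x t $ j))"

(* A real matrix is viewed over the complex numbers: its eigenvalues need not be real. *)
definition eigenvalues :: "real^'n^'n \<Rightarrow> complex set" where
  "eigenvalues A = {c. \<exists>v :: complex^'n. v \<noteq> 0 \<and> map_matrix complex_of_real A *v v = c *s v}"

end

theory Submission
  imports Defs
begin

text \<open>
  Write \<open>\<Sigma>\<close> for the inner product matrix of the trajectory \<open>x\<close>. Since
  \<open>w \<bullet> \<Sigma> w = \<integral> (w \<bullet> x t)\<^sup>2 dt\<close> and \<open>x\<close> is continuous, the kernel of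
  \<open>\<Sigma>\<close> consists of the vectors orthogonal to the whole trajectory
  (\<open>inner_product_matrix_kernel\<close>). The theorem says that such a nonzero vector exists
  exactly when another system matrix produces the same trajectory.

  If \<open>w \<noteq> 0\<close> is orthogonal to the trajectory, then adding the rank-one matrix \<open>w w\<^sup>T\<close> to
  \<open>A\<close> changes the system matrix but not its action on any \<open>x t\<close>. So \<open>x\<close> also solves the
  perturbed system, and by uniqueness of solutions both systems have the trajectory \<open>x\<close>.
  Conversely, if \<open>A\<close> and \<open>B\<close> have the same trajectory, differentiating it gives
  \<open>(A - B) x t = 0\<close>, so every row of \<open>A - B\<close> is orthogonal to the trajectory and lies in the
  kernel of \<open>\<Sigma>\<close>; if \<open>\<Sigma>\<close> is invertible, all rows vanish.

  The analytic input is that the exponential series solves the initial value problem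
  (\<open>trajectory_has_vector_derivative\<close>), and that solutions are unique
  (\<open>linear_ode_solution_unique\<close>).
\<close>

section \<open>The exponential series as a solution\<close>

lemma matrix_power_Suc: "matrix_power A (Suc k) = A ** matrix_power A k"
  by (simp add: matrix_power_def)

lemma matrix_power_scaleR: "matrix_power (t *\<^sub>R A) k = t ^ k *\<^sub>R matrix_power A k"
proof (induction k)
  case 0
  then show ?case by (simp add: matrix_power_def)
next
  case (Suc k)
  then show ?case
    by (simp add: matrix_power_Suc matrix_scalar_ac mult.commute flip: scalar_matrix_assoc)
qed

text \<open>
  Left multiplication by \<open>A\<close> is a linear map on the finite-dimensional space of matrices,
  hence bounded, and \<open>K\<close> is a bound for it.
\<close>

lemma matrix_power_norm_bound:
  fixes A :: "real^'n^'n"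
  obtains K where "\<And>k. norm (matrix_power A k) \<le> norm (mat 1 :: real^'n^'n) * K ^ k"
proof -
  have "linear (\<lambda>M::real^'n^'n. A ** M)"
    by (intro linearI) (simp_all add: matrix_add_ldistrib matrix_scalar_ac flip: scalar_matrix_assoc)
  then have "bounded_linear (\<lambda>M::real^'n^'n. A ** M)"
    by (simp add: linear_conv_bounded_linear)
  then obtain K where K: "K > 0" "\<And>M::real^'n^'n. norm (A ** M) \<le> norm M * K"
    using bounded_linear.pos_bounded by blast
  have "norm (matrix_power A k) \<le> norm (mat 1 :: real^'n^'n) * K ^ k" for k
  proof (induction k)
    case 0
    then show ?case by (simp add: matrix_power_def)
  next
    case (Suc k)
    have "norm (matrix_power A (Suc k)) \<le> norm (matrix_power A k) * K"
      by (simp add: matrix_power_Suc K)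
    also have "\<dots> \<le> norm (mat 1 :: real^'n^'n) * K ^ k * K"
      using Suc K by (intro mult_right_mono) auto
    finally show ?case by (simp add: mult_ac)
  qed
  then show thesis using that by blast
qed

lemma matrix_exp_summable:
  fixes A :: "real^'n^'n"
  shows "summable (\<lambda>k. (1 / fact k) *\<^sub>R matrix_power A k)"
proof -
  obtain K where K: "\<And>k. norm (matrix_power A k) \<le> norm (mat 1 :: real^'n^'n) * K ^ k"
    using matrix_power_norm_bound by blast
  have "summable (\<lambda>k. norm (mat 1 :: real^'n^'n) * (inverse (fact k) * K ^ k))"
    by (intro summable_mult summable_exp)
  then show ?thesis
  proof (rule summable_comparison_test')
    fix k :: nat
    show "norm ((1 / fact k) *\<^sub>R matrix_power A k)
        \<le> norm (mat 1 :: real^'n^'n) * (inverse (fact k) * K ^ k)"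
      using mult_left_mono[OF K[of k], of "inverse (fact k)"]
      by (simp add: field_simps)
  qed
qed

text \<open>
  Applying a linear functional turns the matrix exponential into a scalar power series in
  \<open>t\<close>, so that the termwise differentiation of scalar power series becomes applicable.
\<close>

lemma linear_functional_matrix_exp:
  fixes A :: "real^'n^'n" and f :: "real^'n^'n \<Rightarrow> real"
  assumes "linear f"
  shows "summable (\<lambda>k. f (matrix_power A k) / fact k * t ^ k)"
    and "f (matrix_exp (t *\<^sub>R A)) = (\<Sum>k. f (matrix_power A k) / fact k * t ^ k)"
proof -
  have bl: "bounded_linear f"
    using assms by (simp add: linear_conv_bounded_linear)
  have eq: "f ((1 / fact k) *\<^sub>R matrix_power (t *\<^sub>R A) k)
      = f (matrix_power A k) / fact k * t ^ k" for k
    by (simp add: matrix_power_scaleR linear_cmul[OF assms])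
  show "summable (\<lambda>k. f (matrix_power A k) / fact k * t ^ k)"
    using bounded_linear.summable[OF bl matrix_exp_summable[of "t *\<^sub>R A"]] by (simp only: eq)
  show "f (matrix_exp (t *\<^sub>R A)) = (\<Sum>k. f (matrix_power A k) / fact k * t ^ k)"
    using bounded_linear.suminf[OF bl matrix_exp_summable[of "t *\<^sub>R A"]]
    by (simp only: eq matrix_exp_def)
qed

lemma has_vector_derivative_vecI:
  fixes f :: "real \<Rightarrow> real^'n"
  assumes "\<And>i. ((\<lambda>t. f t $ i) has_real_derivative f' $ i) (at t within S)"
  shows "(f has_vector_derivative f') (at t within S)"
  unfolding has_vector_derivative_def
proof (subst has_derivative_componentwise_within, intro ballI)
  fix b :: "real^'n"
  assume "b \<in> Basis"
  then obtain i where "b = axis i 1"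
    by (auto simp: Basis_vec_def)
  then show "((\<lambda>t. f t \<bullet> b) has_derivative (\<lambda>h. (h *\<^sub>R f') \<bullet> b)) (at t within S)"
    using assms[of i] by (simp add: has_field_derivative_def inner_axis mult_commute_abs)
qed

lemma trajectory_has_vector_derivative:
  fixes A :: "real^'n^'n"
  shows "(trajectory A x0 has_vector_derivative A *v trajectory A x0 t) (at t within S)"
proof (rule has_vector_derivative_vecI)
  fix i
  define f where "f M = (M *v x0) $ i" for M :: "real^'n^'n"
  define g where "g M = (A *v (M *v x0)) $ i" for M :: "real^'n^'n"
  define c where "c k = f (matrix_power A k) / fact k" for k
  have f: "linear f"
    unfolding f_def
    by (intro linearI) (simp_all add: matrix_vector_mult_add_rdistrib scaleR_matrix_vector_assoc[symmetric])
  have g: "linear g"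
    unfolding g_def
    by (intro linearI)
      (simp_all add: matrix_vector_mult_add_rdistrib matrix_vector_right_distrib
        scaleR_matrix_vector_assoc[symmetric] matrix_vector_mult_scaleR)
  \<comment> \<open>Shifting the coefficients by one multiplies the powers by \<open>A\<close>.\<close>
  have diffs: "diffs c = (\<lambda>k. g (matrix_power A k) / fact k)"
    by (rule ext)
      (simp add: diffs_def c_def f_def g_def matrix_power_Suc matrix_vector_mul_assoc
        del: of_nat_Suc)
  have "((\<lambda>t. \<Sum>k. c k * t ^ k) has_real_derivative (\<Sum>k. diffs c k * t ^ k)) (at t)"
    unfolding c_def
    by (rule termdiffs_strong_converges_everywhere) (rule linear_functional_matrix_exp(1)[OF f])
  then have "((\<lambda>t. f (matrix_exp (t *\<^sub>R A))) has_real_derivative g (matrix_exp (t *\<^sub>R A))) (at t)"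
    by (simp add: diffs linear_functional_matrix_exp(2)[OF f]
        linear_functional_matrix_exp(2)[OF g] c_def)
  then show "((\<lambda>t. trajectory A x0 t $ i) has_real_derivative (A *v trajectory A x0 t) $ i)
      (at t within S)"
    by (auto simp: trajectory_def f_def g_def intro: has_field_derivative_at_within)
qed

lemma trajectory_0:
  fixes A :: "real^'n^'n"
  shows "trajectory A x0 0 = x0"
proof -
  have "matrix_power (0 :: real^'n^'n) k = (if k = 0 then mat 1 else 0)" for k
    by (cases k) (simp_all add: matrix_power_def matrix_matrix_mult_def vec_eq_iff)
  then have "(\<lambda>k. (1 / fact k) *\<^sub>R matrix_power (0 :: real^'n^'n) k)
      = (\<lambda>k. if k = 0 then mat 1 else 0)"
    by (auto simp: fun_eq_iff)
  then have "matrix_exp (0 :: real^'n^'n) = mat 1"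
    unfolding matrix_exp_def
    using suminf_finite[of "{0}" "\<lambda>k. if k = 0 then mat 1 else 0 :: real^'n^'n"] by simp
  then show ?thesis
    by (simp add: trajectory_def)
qed

section \<open>Uniqueness of solutions\<close>

text \<open>
  Gronwall's argument for the squared norm: along a solution, \<open>(y \<bullet> y)' = 2 (y \<bullet> A y)\<close> is at
  most \<open>2 K (y \<bullet> y)\<close>, where \<open>K\<close> bounds the operator norm of \<open>A\<close>. Hence
  \<open>(y \<bullet> y) exp (- 2 K t)\<close> decreases; it is nonnegative and starts at zero.
\<close>

lemma linear_ode_solution_zero:
  fixes A :: "real^'n^'n" and y :: "real \<Rightarrow> real^'n"
  assumes y: "\<And>t. t \<in> {0..T} \<Longrightarrow> (y has_vector_derivative A *v y t) (at t within {0..T})"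
    and "y 0 = 0" and t: "t \<in> {0..T}"
  shows "y t = 0"
proof -
  define K where "K = onorm ((*v) A)"
  have K: "v \<bullet> (A *v v) \<le> K * (v \<bullet> v)" for v
  proof -
    have "v \<bullet> (A *v v) \<le> norm v * norm (A *v v)"
      by (rule norm_cauchy_schwarz)
    also have "\<dots> \<le> norm v * (K * norm v)"
      unfolding K_def by (intro mult_left_mono onorm) auto
    finally show ?thesis
      by (simp add: power2_eq_square[symmetric] power2_norm_eq_inner[symmetric] mult_ac)
  qed
  define \<phi> where "\<phi> s = (y s \<bullet> y s) * exp (- 2 * K * s)" for s
  have cont: "continuous_on {0..T} y"
    by (rule continuous_on_vector_derivative) (rule y)
  have "\<phi> 0 \<ge> \<phi> t"
  proof (rule DERIV_nonpos_imp_decreasing_open[where f = \<phi>])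
    show "0 \<le> t" using t by simp
    show "continuous_on {0..t} \<phi>"
      unfolding \<phi>_def using t by (intro continuous_intros continuous_on_subset[OF cont]) auto
    fix s
    assume s: "0 < s" "s < t"
    have "(y has_vector_derivative A *v y s) (at s)"
      using y[of s] s t at_within_interior[of s "{0..T}"] by simp
    then have "((\<lambda>s. y s \<bullet> y s) has_real_derivative 2 * (y s \<bullet> (A *v y s))) (at s)"
      unfolding has_vector_derivative_def has_field_derivative_def
      by (auto intro!: derivative_eq_intros simp: inner_commute fun_eq_iff algebra_simps)
    then have "(\<phi> has_real_derivative
        2 * (y s \<bullet> (A *v y s) - K * (y s \<bullet> y s)) * exp (- 2 * K * s)) (at s)"
      unfolding \<phi>_def by (auto intro!: derivative_eq_intros simp: algebra_simps)
    moreover have "2 * (y s \<bullet> (A *v y s) - K * (y s \<bullet> y s)) * exp (- 2 * K * s) \<le> 0"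
      using K[of "y s"] by (simp add: mult_le_0_iff)
    ultimately show "\<exists>d. (\<phi> has_real_derivative d) (at s) \<and> d \<le> 0"
      by blast
  qed
  then have "y t \<bullet> y t \<le> 0"
    using \<open>y 0 = 0\<close> by (simp add: \<phi>_def mult_le_0_iff)
  then show ?thesis
    using inner_gt_zero_iff[of "y t"] by linarith
qed

lemma linear_ode_solution_unique:
  fixes A :: "real^'n^'n" and x :: "real \<Rightarrow> real^'n"
  assumes "\<And>t. t \<in> {0..T} \<Longrightarrow> (x has_vector_derivative A *v x t) (at t within {0..T})"
    and "x 0 = x0" and "t \<in> {0..T}"
  shows "x t = trajectory A x0 t"
proof -
  have "x t - trajectory A x0 t = 0"
  proof (rule linear_ode_solution_zero[where A = A and y = "\<lambda>t. x t - trajectory A x0 t"])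
    fix s
    assume "s \<in> {0..T}"
    then show "((\<lambda>t. x t - trajectory A x0 t) has_vector_derivative
        A *v (x s - trajectory A x0 s)) (at s within {0..T})"
      using has_vector_derivative_diff[OF assms(1) trajectory_has_vector_derivative]
      by (simp add: matrix_vector_mult_diff_distrib)
  qed (use assms(2,3) in \<open>simp_all add: trajectory_0\<close>)
  then show ?thesis
    by simp
qed

section \<open>The kernel of the inner product matrix\<close>

lemma inner_product_matrix_mult:
  fixes x :: "real \<Rightarrow> real^'n"
  assumes "continuous_on {0..T} x"
  shows "(inner_product_matrix T x *v w) $ i = integral {0..T} (\<lambda>t. x t $ i * (w \<bullet> x t))"
proof -
  have "(inner_product_matrix T x *v w) $ i
      = (\<Sum>j\<in>UNIV. integral {0..T} (\<lambda>t. x t $ i * x t $ j * w $ j))"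
    by (simp add: matrix_vector_mult_def inner_product_matrix_def)
  also have "\<dots> = integral {0..T} (\<lambda>t. \<Sum>j\<in>UNIV. x t $ i * x t $ j * w $ j)"
    by (intro integral_sum[symmetric] integrable_continuous_real continuous_intros assms) auto
  also have "\<dots> = integral {0..T} (\<lambda>t. x t $ i * (w \<bullet> x t))"
    by (simp add: inner_vec_def sum_distrib_left mult_ac)
  finally show ?thesis .
qed

lemma inner_product_matrix_quadratic_form:
  fixes x :: "real \<Rightarrow> real^'n"
  assumes "continuous_on {0..T} x"
  shows "w \<bullet> (inner_product_matrix T x *v w) = integral {0..T} (\<lambda>t. (w \<bullet> x t)\<^sup>2)"
proof -
  have "w \<bullet> (inner_product_matrix T x *v w)
      = (\<Sum>i\<in>UNIV. integral {0..T} (\<lambda>t. w $ i * (x t $ i * (w \<bullet> x t))))"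
    by (simp add: inner_vec_def[of w "_ *v _"] inner_product_matrix_mult[OF assms])
  also have "\<dots> = integral {0..T} (\<lambda>t. \<Sum>i\<in>UNIV. w $ i * (x t $ i * (w \<bullet> x t)))"
    by (intro integral_sum[symmetric] integrable_continuous_real continuous_intros assms) auto
  also have "\<dots> = integral {0..T} (\<lambda>t. (w \<bullet> x t)\<^sup>2)"
    by (simp add: inner_vec_def power2_eq_square sum_distrib_right mult_ac)
  finally show ?thesis .
qed

lemma inner_product_matrix_kernel:
  fixes x :: "real \<Rightarrow> real^'n"
  assumes "T > 0" and cont: "continuous_on {0..T} x"
  shows "inner_product_matrix T x *v w = 0 \<longleftrightarrow> (\<forall>t\<in>{0..T}. w \<bullet> x t = 0)"
proof
  assume "inner_product_matrix T x *v w = 0"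
  then have "integral {0..T} (\<lambda>t. (w \<bullet> x t)\<^sup>2) = 0"
    using inner_product_matrix_quadratic_form[OF cont, of w] by simp
  then show "\<forall>t\<in>{0..T}. w \<bullet> x t = 0"
    using integral_eq_0_iff[of 0 T "\<lambda>t. (w \<bullet> x t)\<^sup>2"] \<open>T > 0\<close> cont
    by (simp add: continuous_intros)
next
  assume "\<forall>t\<in>{0..T}. w \<bullet> x t = 0"
  then have "integral {0..T} (\<lambda>t. x t $ i * (w \<bullet> x t)) = integral {0..T} (\<lambda>t. 0)" for i
    by (intro integral_cong) simp
  then show "inner_product_matrix T x *v w = 0"
    by (simp add: vec_eq_iff inner_product_matrix_mult[OF cont])
qed

section \<open>Identifiability\<close>

text \<open>
  Two linear systems sharing a solution have the same velocities along it, so the rows of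
  \<open>A - B\<close> are orthogonal to the solution on the open interval, where the derivative is
  two-sided, and by continuity on the closed one.
\<close>

lemma shared_trajectory_row_orthogonal:
  fixes A B :: "real^'n^'n"
  assumes "T > 0" and eq: "\<And>t. 0 < t \<Longrightarrow> t < T \<Longrightarrow> trajectory A x0 t = trajectory B x0 t"
    and t: "t \<in> {0..T}"
  shows "row i (A - B) \<bullet> trajectory A x0 t = 0"
proof -
  have cont: "continuous_on {0..T} (trajectory A x0)"
    by (rule continuous_on_vector_derivative) (rule trajectory_has_vector_derivative)
  have "row i (A - B) \<bullet> trajectory A x0 s = 0" if s: "s \<in> {0<..<T}" for s
  proof -
    have "(trajectory B x0 has_vector_derivative A *v trajectory A x0 s) (at s)"
      using has_vector_derivative_transform_within_open[OF trajectory_has_vector_derivative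
          open_greaterThanLessThan s] eq
      by auto
    then have "A *v trajectory A x0 s = B *v trajectory B x0 s"
      using trajectory_has_vector_derivative vector_derivative_unique_at by blast
    then have "(A - B) *v trajectory A x0 s = 0"
      using eq[of s] s by (simp add: matrix_vector_mult_diff_rdistrib)
    then show ?thesis
      by (metis matrix_vector_mul_component row_def vec_lambda_eta zero_index)
  qed
  then show ?thesis
    using continuous_constant_on_closure[of "{0<..<T}" "\<lambda>t. row i (A - B) \<bullet> trajectory A x0 t" 0 t]
      \<open>T > 0\<close> t cont
    by (simp add: continuous_intros)
qed

text \<open>
  The perturbation \<open>w w\<^sup>T\<close> maps every state of the trajectory to zero, so adding it to \<open>A\<close>
  leaves the velocities along the trajectory unchanged. It is nonzero because it does not
  annihilate \<open>w\<close>.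
\<close>

lemma not_identifiable_if_orthogonal:
  fixes A :: "real^'n^'n"
  assumes "w \<noteq> 0" and orth: "\<And>t. t \<in> {0..T} \<Longrightarrow> w \<bullet> trajectory A x0 t = 0"
  shows "\<not> identifiable_at T A x0"
proof -
  define P :: "real^'n^'n" where "P = (\<chi> i j. w $ i * w $ j)"
  have P: "P *v v = (w \<bullet> v) *\<^sub>R w" for v
    by (simp add: P_def vec_eq_iff matrix_vector_mult_def inner_vec_def sum_distrib_left mult_ac)
  have "P *v w \<noteq> 0"
    using \<open>w \<noteq> 0\<close> by (simp add: P)
  then have "A + P \<noteq> A"
    by auto
  moreover have "trajectory A x0 t = trajectory (A + P) x0 t" if "t \<in> {0..T}" for t
  proof (rule linear_ode_solution_unique[OF _ _ that])
    show "trajectory A x0 0 = x0"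
      by (rule trajectory_0)
  next
    fix s
    assume "s \<in> {0..T}"
    then have "A *v trajectory A x0 s = (A + P) *v trajectory A x0 s"
      using orth by (simp add: matrix_vector_mult_add_rdistrib P)
    then show "(trajectory A x0 has_vector_derivative (A + P) *v trajectory A x0 s)
        (at s within {0..T})"
      using trajectory_has_vector_derivative by metis
  qed
  ultimately show ?thesis
    unfolding identifiable_at_def by (metis atLeastAtMost_iff less_imp_le)
qed

lemma invertible_iff_trivial_kernel:
  fixes M :: "real^'n^'n"
  shows "invertible M \<longleftrightarrow> (\<forall>v. M *v v = 0 \<longrightarrow> v = 0)"
  by (simp add: invertible_left_inverse matrix_left_invertible_ker)

theorem theorem3p2:
  fixes A :: "real^'n^'n" and x :: "real \<Rightarrow> real^'n" and x0 :: "real^'n" and T :: real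
  assumes "T > 0"
    and "card (eigenvalues A) = CARD('n)"
    and "\<forall>t\<in>{0..T}. (x has_vector_derivative A *v x t) (at t within {0..T})"
    and "x 0 = x0"
  shows "identifiable_at T A x0 \<longleftrightarrow> invertible (inner_product_matrix T x)"
proof -
  have x: "x t = trajectory A x0 t" if "t \<in> {0..T}" for t
    using linear_ode_solution_unique assms(3,4) that by blast
  have "continuous_on {0..T} x"
    by (rule continuous_on_vector_derivative) (use assms(3) in blast)
  note kernel = inner_product_matrix_kernel[OF \<open>T > 0\<close> this]
  show ?thesis
  proof
    assume "identifiable_at T A x0"
    then have "w = 0" if "inner_product_matrix T x *v w = 0" for w
      using that not_identifiable_if_orthogonal[of w T A x0] x by (auto simp: kernel)
    then show "invertible (inner_product_matrix T x)"
      by (simp add: invertible_iff_trivial_kernel)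
  next
    assume inv: "invertible (inner_product_matrix T x)"
    have "A = B" if eq: "\<And>t. 0 < t \<Longrightarrow> t < T \<Longrightarrow> trajectory A x0 t = trajectory B x0 t" for B
    proof -
      have "inner_product_matrix T x *v row i (A - B) = 0" for i
        using shared_trajectory_row_orthogonal[OF \<open>T > 0\<close> eq] x by (simp add: kernel)
      then have "row i (A - B) = 0" for i
        using inv by (simp add: invertible_iff_trivial_kernel)
      then show "A = B"
        by (simp add: row_def vec_eq_iff)
    qed
    then show "identifiable_at T A x0"
      unfolding identifiable_at_def by metis
  qed
qed

end
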